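(* Let $R$ be a commutative ring with unity, let $\mathcal{A}$ be a commutative unital $R$-algebra, and let $\sigma,\tau$ be two different non-zero unital $R$-algebra endomorphisms of $\mathcal{A}$. Suppose that $\mathcal{A}$ is of finite rank $n$ as an $R$-module, with $R$-basis $\{\alpha_{1},\alpha_{2},\dots,\alpha_{n}\}$. Then a $(\sigma,\tau)$-derivation $D:\mathcal{A}\to\mathcal{A}$ is inner if and only if there exists some $\beta\in\mathcal{A}$ such that $D(\alpha_{i})=\beta(\tau-\sigma)(\alpha_{i})$ for all $i\in\{1,2,\dots,n\}$.
   Context: A $(\sigma,\tau)$-derivation of $\mathcal{A}$ is an $R$-linear map $D:\mathcal{A}\to\mathcal{A}$ with $D(xy)=D(x)\tau(y)+\sigma(x)D(y)$ for all $x,y\in\mathcal{A}$. It is called inner if there exists $\beta\in\mathcal{A}$ with $D(x)=\beta\tau(x)-\sigma(x)\beta$ for all $x\in\mathcal{A}$. Here $(\tau-\sigma)(x)=\tau(x)-\sigma(x)$. *)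

theory Defs
  imports Complex_Main
begin

text \<open>
  The rings are types of class \<^class>\<open>comm_ring_1\<close>, which includes
  \<open>0 \<noteq> 1\<close>. An algebra with two different endomorphisms is nonzero, and so is its
  base ring, so this excludes nothing in the theorem.
\<close>

locale comm_algebra = module scale
  for scale :: "'r::comm_ring_1 \<Rightarrow> 'a::comm_ring_1 \<Rightarrow> 'a" (infixr \<open>*s\<close> 75) +
  assumes scale_mult_left: "r *s (x * y) = (r *s x) * y"
begin

definition unital_endomorphism :: "('a \<Rightarrow> 'a) \<Rightarrow> bool" where
  "unital_endomorphism f \<longleftrightarrow>
     module_hom scale scale f \<and> (\<forall>x y. f (x * y) = f x * f y) \<and> f 1 = 1"

definition derivation :: "('a \<Rightarrow> 'a) \<Rightarrow> ('a \<Rightarrow> 'a) \<Rightarrow> ('a \<Rightarrow> 'a) \<Rightarrow> bool" where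
  "derivation \<sigma> \<tau> D \<longleftrightarrow>
     module_hom scale scale D \<and> (\<forall>x y. D (x * y) = D x * \<tau> y + \<sigma> x * D y)"

text \<open>Injectivity makes the family free, not merely its set of values.\<close>

definition is_basis :: "nat \<Rightarrow> (nat \<Rightarrow> 'a) \<Rightarrow> bool" where
  "is_basis n \<alpha> \<longleftrightarrow>
     inj_on \<alpha> {1..n} \<and> independent (\<alpha> ` {1..n}) \<and> span (\<alpha> ` {1..n}) = UNIV"

end

definition is_inner :: "('a::comm_ring_1 \<Rightarrow> 'a) \<Rightarrow> ('a \<Rightarrow> 'a) \<Rightarrow> ('a \<Rightarrow> 'a) \<Rightarrow> bool" where
  "is_inner \<sigma> \<tau> D \<longleftrightarrow> (\<exists>\<beta>. \<forall>x. D x = \<beta> * \<tau> x - \<sigma> x * \<beta>)"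

end

theory Submission
  imports Defs
begin

text \<open>Since the algebra is commutative, \<beta> * \<tau> x - \<sigma> x * \<beta> equals
  \<beta> * (\<tau> - \<sigma>) x, so D is inner exactly when it coincides with such a multiple of
  \<tau> - \<sigma>. Both maps are R-linear, and linear maps that agree on a spanning set agree
  everywhere (\<open>module_hom_eq_on_span\<close>); the basis is such a set.\<close>

theorem theorem2p26:
  fixes scale :: "'r::comm_ring_1 \<Rightarrow> 'a::comm_ring_1 \<Rightarrow> 'a"
    and \<sigma> \<tau> D :: "'a \<Rightarrow> 'a"
    and n :: nat
    and \<alpha> :: "nat \<Rightarrow> 'a"
  assumes "comm_algebra scale"
    and "comm_algebra.unital_endomorphism scale \<sigma>" and "\<sigma> \<noteq> (\<lambda>_. 0)"
    and "comm_algebra.unital_endomorphism scale \<tau>" and "\<tau> \<noteq> (\<lambda>_. 0)"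
    and "\<sigma> \<noteq> \<tau>"
    and "comm_algebra.is_basis scale n \<alpha>"
    and "comm_algebra.derivation scale \<sigma> \<tau> D"
  shows "is_inner \<sigma> \<tau> D \<longleftrightarrow> (\<exists>\<beta>. \<forall>i\<in>{1..n}. D (\<alpha> i) = \<beta> * (\<tau> - \<sigma>) (\<alpha> i))"
proof -
  interpret comm_algebra scale by fact
  have \<sigma>: "module_hom scale scale \<sigma>" and \<tau>: "module_hom scale scale \<tau>"
    using assms(2,4) by (simp_all add: unital_endomorphism_def)
  have D: "module_hom scale scale D"
    using assms(8) by (simp add: derivation_def)
  have span: "span (\<alpha> ` {1..n}) = UNIV"
    using assms(7) by (simp add: is_basis_def)
  have twist: "module_hom scale scale (\<lambda>x. \<beta> * (\<tau> - \<sigma>) x)" for \<beta>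
  proof -
    interpret \<sigma>: module_hom scale scale \<sigma> by (fact \<sigma>)
    interpret \<tau>: module_hom scale scale \<tau> by (fact \<tau>)
    \<comment> \<open>\<open>scale_mult_left\<close> extracts a scalar from the left factor only;
      commutativity carries it past \<beta>, so multiplication by \<beta> is R-linear.\<close>
    have "\<beta> * scale r x = scale r (\<beta> * x)" for r x
      using scale_mult_left[of r x \<beta>] by (simp add: mult.commute)
    then show ?thesis
      by unfold_locales
        (simp_all add: \<sigma>.add \<tau>.add \<sigma>.scale \<tau>.scale algebra_simps)
  qed
  interpret module_pair scale scale ..
  \<comment> \<open>The equivalence holds for each fixed \<beta>, so the same witness serves in both
    directions.\<close>
  have "(\<forall>x. D x = \<beta> * (\<tau> - \<sigma>) x) \<longleftrightarrow> (\<forall>i\<in>{1..n}. D (\<alpha> i) = \<beta> * (\<tau> - \<sigma>) (\<alpha> i))" for \<beta>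
    using module_hom_eq_on_span[OF D twist, of "\<alpha> ` {1..n}" \<beta>] span by auto
  then show ?thesis
    \<comment> \<open>Distributing and commuting turns \<beta> * (\<tau> - \<sigma>) x into the
      expression in \<open>is_inner\<close>.\<close>
    by (simp add: is_inner_def right_diff_distrib mult.commute)
qed

end
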